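(* Let $M\in\mathbb{R}^{n\times n}$ be a square matrix partitioned as $M=\begin{bmatrix}A_M & B_M \\ F_M & C_M\end{bmatrix}$ with sample matrix $A_M\in\mathbb{R}^{s\times s}$. Let $A_M=U\Lambda U^{-1}$ be the eigen-decomposition of $A_M$, where $U\in\mathbb{R}^{s\times s}$ is the matrix of eigenvectors and $\Lambda\in\mathbb{R}^{s\times s}$ is the diagonal matrix of eigenvalues, and assume the eigenvalues are non-zero. Let $$\hat M=\begin{bmatrix}A_M \\ F_M\end{bmatrix}A_M^{+}\begin{bmatrix}A_M & B_M\end{bmatrix}$$ be the Nyström approximation of $M$. Define $$\hat U=\begin{bmatrix}U \\ F_MU\Lambda^{-1}\end{bmatrix},\quad \hat V=\begin{bmatrix}U^{-1} & \Lambda^{-1}U^{-1}B_M\end{bmatrix},\quad G_U=\hat U\Lambda^{1/2},\quad G_V=\Lambda^{1/2}\hat V.$$ Compute the eigenvalue decomposition of the $s\times s$ matrix $G_VG_U$ as $G_VG_U=F\Sigma F^{-1}$, and put $U_o=G_UF\Sigma^{-1/2}$ and $V_o=\Sigma^{-1/2}F^{-1}G_V$. Then the eigenvalues of $\hat M$ are given by $\Sigma$, and its right and left eigenvectors are given by $U_o$ and $V_o$, respectively: the left and right eigenvectors are mutually orthogonal, $V_oU_o=I$, and $U_o\Sigma V_o=\hat M$, so that $U_o\Sigma V_o$ is the eigenvalue decomposition of $\hat M$. It is obtained without explicitly forming $\hat M$, and the computational complexity of the procedure is $O(s^2n)$, the bottleneck being the formation of $G_VG_U$.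
   Context: Here $B_M\in\mathbb{R}^{s\times(n-s)}$, $F_M\in\mathbb{R}^{(n-s)\times s}$, $C_M\in\mathbb{R}^{(n-s)\times(n-s)}$, and $A_M^{+}$ denotes the pseudo-inverse of $A_M$. One has $\hat M=\hat U\Lambda\hat V=\begin{bmatrix}A_M & B_M \\ F_M & F_MA_M^{+}B_M\end{bmatrix}$, i.e. the Nyström approximation leaves $A_M,B_M,F_M$ unchanged and approximates $C_M$ by $F_MA_M^{+}B_M$. In $G_VG_U=F\Sigma F^{-1}$ the matrix $\Sigma$ is the diagonal matrix of eigenvalues and $F$ the matrix of eigenvectors. For a diagonal matrix, the exponents $1/2$ and $-1/2$ denote the diagonal matrices of square roots and of inverse square roots of the diagonal entries. The number $s$ is the sample size and $n$ is the size of $M$.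
   Formalization: The eigenvalues in Σ are assumed non-zero (else Σ^{-1/2} is undefined; e.g. A_M=1, B_M=1, F_M=-1), and an eigendecomposition of a k×k matrix, which has no finite exact cost, is assumed to cost O(k^3) operations. *)

theory Defs
  imports "Jordan_Normal_Form.Char_Poly"
begin

definition append_cols :: "'a::zero mat \<Rightarrow> 'a mat \<Rightarrow> 'a mat" (infixr "@\<^sub>c" 65) where
  "A @\<^sub>c B = four_block_mat A B (0\<^sub>m 0 (dim_col A)) (0\<^sub>m 0 (dim_col B))"

(* Moore-Penrose conditions for a real matrix *)
definition is_pseudo_inverse :: "real mat \<Rightarrow> real mat \<Rightarrow> bool" where
  "is_pseudo_inverse A X \<longleftrightarrow> X \<in> carrier_mat (dim_col A) (dim_row A)
     \<and> A * X * A = A \<and> X * A * X = X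
     \<and> transpose_mat (A * X) = A * X \<and> transpose_mat (X * A) = X * A"

definition pseudo_inverse :: "real mat \<Rightarrow> real mat" where
  "pseudo_inverse A = (THE X. is_pseudo_inverse A X)"

lemma is_pseudo_inverse_unique:
  assumes X: "is_pseudo_inverse A X" and Y: "is_pseudo_inverse A Y"
  shows "X = Y"
proof -
  define r c where "r = dim_row A" and "c = dim_col A"
  have A: "A \<in> carrier_mat r c" unfolding r_def c_def by (rule carrier_matI[OF refl refl])
  have XC: "X \<in> carrier_mat c r" and YC: "Y \<in> carrier_mat c r"
    using X Y unfolding is_pseudo_inverse_def r_def c_def by blast+
  have x1: "A * X * A = A" and x2: "X * A * X = X"
    and x3: "transpose_mat (A * X) = A * X" and x4: "transpose_mat (X * A) = X * A"
    using X unfolding is_pseudo_inverse_def by blast+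
  have y1: "A * Y * A = A" and y2: "Y * A * Y = Y"
    and y3: "transpose_mat (A * Y) = A * Y" and y4: "transpose_mat (Y * A) = Y * A"
    using Y unfolding is_pseudo_inverse_def by blast+
  note AX = mult_carrier_mat[OF A XC] and AY = mult_carrier_mat[OF A YC]
    and XA = mult_carrier_mat[OF XC A] and YA = mult_carrier_mat[OF YC A]
  have "A * X = (A * Y) * (A * X)"
    unfolding assoc_mult_mat[OF AY A XC, symmetric] y1 ..
  hence "transpose_mat (A * X) = transpose_mat ((A * Y) * (A * X))" by (rule arg_cong)
  hence "A * X = (A * X) * (A * Y)" unfolding transpose_mult[OF AY AX] x3 y3 .
  also have "\<dots> = A * Y" unfolding assoc_mult_mat[OF AX A YC, symmetric] x1 ..
  finally have e1: "A * X = A * Y" .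
  have "X * A = (X * A) * (Y * A)"
    unfolding assoc_mult_mat[OF XC A YA] assoc_mult_mat[OF A YC A, symmetric] y1 ..
  hence "transpose_mat (X * A) = transpose_mat ((X * A) * (Y * A))" by (rule arg_cong)
  hence "X * A = (Y * A) * (X * A)" unfolding transpose_mult[OF XA YA] x4 y4 .
  also have "\<dots> = Y * A"
    unfolding assoc_mult_mat[OF YC A XA] assoc_mult_mat[OF A XC A, symmetric] x1 ..
  finally have e2: "X * A = Y * A" .
  have "X = Y * A * X" using x2 unfolding e2 by (rule sym)
  also have "\<dots> = Y * (A * X)" by (rule assoc_mult_mat[OF YC A XC])
  also have "\<dots> = Y * A * Y" unfolding e1 by (rule assoc_mult_mat[OF YC A YC, symmetric])
  finally show ?thesis unfolding y2 .
qed

lemma pseudo_inverse_inverse: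
  assumes A: "A \<in> carrier_mat n n" and X: "X \<in> carrier_mat n n"
    and AX: "A * X = 1\<^sub>m n" and XA: "X * A = 1\<^sub>m n"
  shows "pseudo_inverse A = X"
  unfolding pseudo_inverse_def
proof (rule the_equality)
  have "X \<in> carrier_mat (dim_col A) (dim_row A)"
    using X unfolding carrier_matD(1)[OF A] carrier_matD(2)[OF A] .
  then show *: "is_pseudo_inverse A X"
    unfolding is_pseudo_inverse_def AX XA left_mult_one_mat[OF A] left_mult_one_mat[OF X]
      transpose_one by blast
  show "Y = X" if "is_pseudo_inverse A Y" for Y by (rule is_pseudo_inverse_unique[OF that *])
qed

definition nystrom :: "real mat \<Rightarrow> real mat \<Rightarrow> real mat \<Rightarrow> real mat" where
  "nystrom A B F = (A @\<^sub>r F) * pseudo_inverse A * (A @\<^sub>c B)"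

definition eigen_decomposition ::
    "'a::comm_ring_1 mat \<Rightarrow> 'a mat \<Rightarrow> 'a mat \<Rightarrow> 'a mat \<Rightarrow> bool" where
  "eigen_decomposition A P D Q \<longleftrightarrow> similar_mat_wit A D P Q \<and> diagonal_mat D"

(* Real input data are embedded into the complex matrices: the diagonal entries under the
   square roots may be negative, and the second decomposition may be complex. *)
abbreviation cmat :: "real mat \<Rightarrow> complex mat" where
  "cmat \<equiv> map_mat complex_of_real"

definition diag_map :: "(complex \<Rightarrow> complex) \<Rightarrow> complex mat \<Rightarrow> complex mat" where
  "diag_map f D = mat_diag (dim_row D) (\<lambda>i. f (D $$ (i, i)))"

definition diag_inv :: "complex mat \<Rightarrow> complex mat" where
  "diag_inv = diag_map inverse"

(* principal square roots *)
definition diag_sqrt :: "complex mat \<Rightarrow> complex mat" where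
  "diag_sqrt = diag_map csqrt"

definition diag_inv_sqrt :: "complex mat \<Rightarrow> complex mat" where
  "diag_inv_sqrt D = diag_inv (diag_sqrt D)"

(* Cost model.  A counted computation is a value together with the list of matrix steps
   performed: for each step its number of scalar operations and the matrices it forms. *)

type_synonym step = "nat \<times> complex mat list"
type_synonym 'x counted = "'x \<times> step list"

definition ret :: "'x \<Rightarrow> 'x counted" where
  "ret x = (x, [])"

definition seq :: "'x counted \<Rightarrow> ('x \<Rightarrow> 'y counted) \<Rightarrow> 'y counted" (infixr "\<rhd>" 54) where
  "m \<rhd> f = (let (x, l) = m; (y, l') = f x in (y, l @ l'))"

definition steps :: "'x counted \<Rightarrow> step list" where
  "steps m = snd m"

definition total_cost :: "'x counted \<Rightarrow> nat" where
  "total_cost m = sum_list (map fst (steps m))"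

(* Schoolbook product of a p x q and a q x r matrix: each of the p * r entries takes
   q multiplications and q - 1 additions. *)
definition mult_cost :: "nat \<Rightarrow> nat \<Rightarrow> nat \<Rightarrow> nat" where
  "mult_cost p q r = p * r * (2 * q - 1)"

definition mult_step :: "complex mat \<Rightarrow> complex mat \<Rightarrow> complex mat counted" where
  "mult_step X Y = (X * Y, [(mult_cost (dim_row X) (dim_col X) (dim_col Y), [X * Y])])"

(* products with a diagonal matrix D: one multiplication per entry of X *)
definition scale_rows_step :: "complex mat \<Rightarrow> complex mat \<Rightarrow> complex mat counted" where
  "scale_rows_step D X = (D * X, [(dim_row X * dim_col X, [D * X])])"

definition scale_cols_step :: "complex mat \<Rightarrow> complex mat \<Rightarrow> complex mat counted" where
  "scale_cols_step X D = (X * D, [(dim_row X * dim_col X, [X * D])])"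

(* stacking blocks is charged one operation per copied entry *)
definition append_rows_step :: "complex mat \<Rightarrow> complex mat \<Rightarrow> complex mat counted" where
  "append_rows_step X Y = (X @\<^sub>r Y, [((dim_row X + dim_row Y) * dim_col X, [X @\<^sub>r Y])])"

definition append_cols_step :: "complex mat \<Rightarrow> complex mat \<Rightarrow> complex mat counted" where
  "append_cols_step X Y = (X @\<^sub>c Y, [(dim_row X * (dim_col X + dim_col Y), [X @\<^sub>c Y])])"

(* only the diagonal entries are touched *)
definition diag_inv_step :: "complex mat \<Rightarrow> complex mat counted" where
  "diag_inv_step D = (diag_inv D, [(dim_row D, [diag_inv D])])"

definition diag_sqrt_step :: "complex mat \<Rightarrow> complex mat counted" where
  "diag_sqrt_step D = (diag_sqrt D, [(dim_row D, [diag_sqrt D])])"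

type_synonym eigensolver = "complex mat \<Rightarrow> complex mat \<times> complex mat \<times> complex mat"

(* An eigensolver returns (P, D, inverse of P); ec k is its cost on a k x k matrix. *)
definition eig_step ::
    "(nat \<Rightarrow> nat) \<Rightarrow> eigensolver \<Rightarrow> complex mat \<Rightarrow> (complex mat \<times> complex mat \<times> complex mat) counted" where
  "eig_step ec eig X = (eig X, [(ec (dim_row X), case eig X of (P, D, Q) \<Rightarrow> [P, D, Q])])"

(* eigA and eigG are kept separate so that the two eigendecompositions can be chosen
   independently, even if they are applied to the same matrix. *)
definition nystrom_evd ::
    "(nat \<Rightarrow> nat) \<Rightarrow> eigensolver \<Rightarrow> eigensolver \<Rightarrow> complex mat \<Rightarrow> complex mat \<Rightarrow> complex mat
      \<Rightarrow> (complex mat \<times> complex mat \<times> complex mat) counted" where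
  "nystrom_evd ec eigA eigG A B F =
     (eig_step ec eigA A \<rhd> (\<lambda>(U, L, Ui).
      diag_inv_step L \<rhd> (\<lambda>Li.
      diag_sqrt_step L \<rhd> (\<lambda>Lh.
      mult_step F U \<rhd> (\<lambda>FU.
      scale_cols_step FU Li \<rhd> (\<lambda>FUL.
      append_rows_step U FUL \<rhd> (\<lambda>Uhat.
      mult_step Ui B \<rhd> (\<lambda>UB.
      scale_rows_step Li UB \<rhd> (\<lambda>LUB.
      append_cols_step Ui LUB \<rhd> (\<lambda>Vhat.
      scale_cols_step Uhat Lh \<rhd> (\<lambda>GU.
      scale_rows_step Lh Vhat \<rhd> (\<lambda>GV.
      mult_step GV GU \<rhd> (\<lambda>G.
      eig_step ec eigG G \<rhd> (\<lambda>(P, S, Pi).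
      diag_sqrt_step S \<rhd> (\<lambda>Sh.
      diag_inv_step Sh \<rhd> (\<lambda>Shi.
      mult_step GU P \<rhd> (\<lambda>GUP.
      scale_cols_step GUP Shi \<rhd> (\<lambda>Uo.
      mult_step Pi GV \<rhd> (\<lambda>PGV.
      scale_rows_step Shi PGV \<rhd> (\<lambda>Vo.
      ret (Uo, S, Vo)))))))))))))))))))))"

end

(* With E = Sigma^(-1/2), the relation GV GU = F Sigma F^-1 gives Vo Uo = E Sigma E = I and
   Uo Sigma Vo = GU GV, and GU GV = Mhat because A_M is invertible with pseudo-inverse
   U Lambda^-1 U^-1.  The spectrum of Mhat = (Uo Sigma) Vo is that of Vo (Uo Sigma) = Sigma
   up to zeros: XY and YX have the same characteristic polynomial up to a power of x.
   Each of the 19 matrix steps costs at most as much as forming GV GU, up to the factor c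
   of the eigensolvers; hence the constant 38 (1 + c). *)

theory Submission
  imports Defs
begin

section \<open>Stacked matrices: products and entrywise maps\<close>

lemma carrier_append_cols [simp, intro]:
  "A \<in> carrier_mat nr nc1 \<Longrightarrow> B \<in> carrier_mat nr nc2 \<Longrightarrow> A @\<^sub>c B \<in> carrier_mat nr (nc1 + nc2)"
  unfolding append_cols_def by auto

lemma append_dim [simp]:
  "dim_row (A @\<^sub>r B) = dim_row A + dim_row B" "dim_col (A @\<^sub>c B) = dim_col A + dim_col B"
  unfolding append_rows_def append_cols_def by simp_all

lemma append_rows_dim_col [simp]: "dim_col (A @\<^sub>r B) = dim_col A"
  and append_cols_dim_row [simp]: "dim_row (A @\<^sub>c B) = dim_row A"
  unfolding append_rows_def append_cols_def by simp_all

lemma append_rows_mult: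
  assumes "A \<in> carrier_mat nr1 n" "B \<in> carrier_mat nr2 n" "X \<in> carrier_mat n nc"
  shows "(A @\<^sub>r B) * X = (A * X) @\<^sub>r (B * X)"
  by (rule eq_matI) (use assms in \<open>auto simp: append_rows_def scalar_prod_def\<close>)

lemma mult_append_cols:
  assumes "X \<in> carrier_mat nr n" "A \<in> carrier_mat n nc1" "B \<in> carrier_mat n nc2"
  shows "X * (A @\<^sub>c B) = (X * A) @\<^sub>c (X * B)"
  by (rule eq_matI) (use assms in \<open>auto simp: append_cols_def scalar_prod_def\<close>)

lemma map_mat_append_rows:
  assumes "A \<in> carrier_mat nr1 nc" "B \<in> carrier_mat nr2 nc"
  shows "map_mat f (A @\<^sub>r B) = map_mat f A @\<^sub>r map_mat f B"
  by (rule eq_matI) (use assms in \<open>auto simp: append_rows_def\<close>)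

lemma map_mat_append_cols:
  assumes "A \<in> carrier_mat nr nc1" "B \<in> carrier_mat nr nc2"
  shows "map_mat f (A @\<^sub>c B) = map_mat f A @\<^sub>c map_mat f B"
  by (rule eq_matI) (use assms in \<open>auto simp: append_cols_def\<close>)

section \<open>Characteristic polynomials of block matrices and of products in either order\<close>

text \<open>The characteristic matrix \<open>?cm\<close> of a block triangular matrix is block
  triangular again, with the characteristic matrices of A and D on its diagonal, so its determinant
  splits.\<close>

lemma char_poly_four_block_upper_right_zero:
  fixes A :: "'a::idom mat"
  assumes A: "A \<in> carrier_mat n n" and C: "C \<in> carrier_mat m n" and D: "D \<in> carrier_mat m m"
  shows "char_poly (four_block_mat A (0\<^sub>m n m) C D) = char_poly A * char_poly D"
proof -
  let ?cm = "\<lambda>A. [:0, 1:] \<cdot>\<^sub>m 1\<^sub>m (dim_row A) + map_mat (\<lambda>a. [:- a:]) A"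
  have "?cm (four_block_mat A (0\<^sub>m n m) C D)
      = four_block_mat (?cm A) (0\<^sub>m n m) (map_mat (\<lambda>a. [:- a:]) C) (?cm D)"
    by (rule eq_matI, insert A C D, auto simp: one_poly_def)
  moreover have "det \<dots> = det (?cm A) * det (?cm D)"
    by (rule det_four_block_mat_upper_right_zero[OF _ refl]) (use A C D in auto)
  ultimately show ?thesis
    unfolding char_poly_defs using A D by simp
qed

lemma diagonal_char_poly:
  fixes D :: "'a::comm_ring_1 mat"
  assumes D: "D \<in> carrier_mat n n" and "diagonal_mat D"
  shows "char_poly D = (\<Prod>i<n. [:- D $$ (i, i), 1:])"
proof -
  have "upper_triangular D"
    using assms unfolding upper_triangular_def diagonal_mat_def by auto
  then have "char_poly D = prod_list (map (\<lambda>a. [:- a, 1:]) (diag_mat D))"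
    by (rule char_poly_upper_triangular[OF D])
  also have "\<dots> = (\<Prod>i = 0..<n. [:- D $$ (i, i), 1:])"
    using D unfolding diag_mat_def
    by (simp add: prod.distinct_set_conv_list[symmetric] o_def)
  finally show ?thesis by (simp add: atLeast0LessThan)
qed

lemma char_poly_zero_mat: "char_poly (0\<^sub>m n n :: 'a::comm_ring_1 mat) = monom 1 n"
  by (subst diagonal_char_poly[of _ n])
     (auto simp: diagonal_mat_def monom_altdef)

lemma char_poly_mult_commute:
  fixes X Y :: "'a::idom mat"
  assumes X: "X \<in> carrier_mat n m" and Y: "Y \<in> carrier_mat m n"
  shows "monom 1 m * char_poly (X * Y) = monom 1 n * char_poly (Y * X)"
proof -
  \<comment> \<open>conjugating by the unipotent block matrix with upper right block X turns
    [[XY, 0], [Y, 0]] into [[0, 0], [Y, YX]]\<close>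
  define N where "N = four_block_mat (X * Y) (0\<^sub>m n m) Y (0\<^sub>m m m)"
  define N' where "N' = four_block_mat (0\<^sub>m n n) (0\<^sub>m n m) Y (Y * X)"
  define S where "S = four_block_mat (1\<^sub>m n) X (0\<^sub>m m n) (1\<^sub>m m)"
  define T where "T = four_block_mat (1\<^sub>m n) (- X) (0\<^sub>m m n) (1\<^sub>m m)"
  note mult = mult_four_block_mat[where ?nr1.0 = n and ?nr2.0 = m and ?n1.0 = n and ?n2.0 = m
      and ?nc1.0 = n and ?nc2.0 = m]
  have carr: "N \<in> carrier_mat (n + m) (n + m)" "N' \<in> carrier_mat (n + m) (n + m)"
    "S \<in> carrier_mat (n + m) (n + m)" "T \<in> carrier_mat (n + m) (n + m)"
    unfolding N_def N'_def S_def T_def using X Y by auto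
  have "X + - X = 0\<^sub>m n m" "- X + X = 0\<^sub>m n m" "- (0\<^sub>m m m :: 'a mat) = 0\<^sub>m m m"
    by (rule eq_matI; use X in auto)+
  then have ST: "S * T = 1\<^sub>m (n + m)" and TS: "T * S = 1\<^sub>m (n + m)"
    unfolding S_def T_def using X by (subst mult; simp)+
  \<comment> \<open>Both sides have the blocks XY, XYX, Y and YX. Checking this intertwining
    relation first leaves T to enter only as the inverse of S.\<close>
  have "N * S = S * N'"
    unfolding N_def N'_def S_def using X Y by (subst (1 2) mult) auto
  then have "S * N' * T = N * (S * T)"
    using assoc_mult_mat[OF carr(1,3,4)] by simp
  then have "N = S * N' * T"
    unfolding ST using carr by simp
  then have "similar_mat N N'"
    using carr by (intro similar_matI[OF _ ST TS]) auto
  then have "char_poly N = char_poly N'"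
    by (rule char_poly_similar)
  \<comment> \<open>The zero diagonal blocks of N and N' contribute the powers
    \<open>monom 1 m\<close> and \<open>monom 1 n\<close>.\<close>
  then show ?thesis
    using X Y unfolding N_def N'_def
    by (simp add: char_poly_four_block_upper_right_zero char_poly_zero_mat mult.commute)
qed

section \<open>Reassociation and cancellation in matrix products\<close>

text \<open>Unlike the carrier premises of assoc_mult_mat, equations between dimensions contain no
  variables that are absent from the conclusion, so the simplifier can discharge them.\<close>

lemma assoc_mult_mat_dim:
  assumes "dim_col X = dim_row Y" "dim_col Y = dim_row Z"
  shows "X * Y * Z = X * (Y * (Z::'a::semiring_0 mat))"
  by (rule assoc_mult_mat[of _ "dim_row X" "dim_col X" _ "dim_col Y" _ "dim_col Z"])
     (use assms in auto)

text \<open>The trailing factor Z is there because \<open>assoc_mult_mat_dim\<close> nests products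
  to the right: inside a longer product an inverse pair X, Y appears as
  \<open>X * (Y * Z)\<close>.\<close>

lemma mult_cancel_left_mat:
  fixes X Y Z :: "'a::semiring_1 mat"
  assumes "X \<in> carrier_mat n m" "Y \<in> carrier_mat m n" "X * Y = 1\<^sub>m n" "dim_row Z = n"
  shows "X * (Y * Z) = Z"
proof -
  have "X * (Y * Z) = (X * Y) * Z"
    using assms(1,2,4) by (simp add: assoc_mult_mat_dim)
  then show ?thesis
    using assms(3,4) by auto
qed

section \<open>Square roots and inverses of diagonal matrices\<close>

lemma diagonal_mat_eq_mat_diag:
  assumes "D \<in> carrier_mat n n" "diagonal_mat D"
  shows "D = mat_diag n (\<lambda>i. D $$ (i, i))"
  by (rule eq_matI) (use assms in \<open>auto simp: mat_diag_def diagonal_mat_def\<close>)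

lemma mat_diag_cong: "(\<And>i. i < n \<Longrightarrow> f i = g i) \<Longrightarrow> mat_diag n f = mat_diag n g"
  unfolding mat_diag_def by (intro cong_mat) auto

lemma diag_map_carrier [simp]:
  "D \<in> carrier_mat n m \<Longrightarrow> diag_map f D \<in> carrier_mat n n"
  unfolding diag_map_def by auto

lemma diag_map_dim [simp]:
  "dim_row (diag_map f D) = dim_row D" "dim_col (diag_map f D) = dim_row D"
  unfolding diag_map_def mat_diag_def by auto

text \<open>The principal branch satisfies \<open>csqrt z ^ 2 = z\<close> for every complex z, so
  negative or non-real eigenvalues cause no difficulty.\<close>

lemma diag_sqrt_square:
  assumes D: "D \<in> carrier_mat n n" "diagonal_mat D"
  shows "diag_sqrt D * diag_sqrt D = D"
proof -
  have "diag_sqrt D * diag_sqrt D = mat_diag n (\<lambda>i. csqrt (D $$ (i, i)) * csqrt (D $$ (i, i)))"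
    using D unfolding diag_sqrt_def diag_map_def by simp
  also have "\<dots> = D"
    by (simp flip: power2_eq_square diagonal_mat_eq_mat_diag[OF D])
  finally show ?thesis .
qed

lemma diag_inv_mult:
  assumes D: "D \<in> carrier_mat n n" "diagonal_mat D" and nz: "\<And>i. i < n \<Longrightarrow> D $$ (i, i) \<noteq> 0"
  shows "diag_inv D * D = 1\<^sub>m n" "D * diag_inv D = 1\<^sub>m n"
proof -
  let ?d = "\<lambda>i. D $$ (i, i)"
  have inv: "diag_inv D = mat_diag n (\<lambda>i. inverse (?d i))"
    using D unfolding diag_inv_def diag_map_def by simp
  note DD = diagonal_mat_eq_mat_diag[OF D]
  have "diag_inv D * D = mat_diag n (\<lambda>i. inverse (?d i)) * mat_diag n ?d"
    using inv DD by (rule arg_cong2)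
  also have "\<dots> = mat_diag n (\<lambda>_. 1)"
    unfolding mat_diag_diag by (rule mat_diag_cong) (simp add: nz)
  finally show "diag_inv D * D = 1\<^sub>m n"
    by simp
  have "D * diag_inv D = mat_diag n ?d * mat_diag n (\<lambda>i. inverse (?d i))"
    using DD inv by (rule arg_cong2)
  also have "\<dots> = mat_diag n (\<lambda>_. 1)"
    unfolding mat_diag_diag by (rule mat_diag_cong) (simp add: nz)
  finally show "D * diag_inv D = 1\<^sub>m n"
    by simp
qed

text \<open>Split D as R R with R = \<open>diag_sqrt D\<close>; each outer factor cancels one R. The
  entries of R are nonzero because those of D are.\<close>

lemma diag_inv_sqrt_sandwich:
  assumes D: "D \<in> carrier_mat n n" "diagonal_mat D" and nz: "\<And>i. i < n \<Longrightarrow> D $$ (i, i) \<noteq> 0"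
  shows "diag_inv_sqrt D * D * diag_inv_sqrt D = 1\<^sub>m n"
proof -
  let ?R = "diag_sqrt D"
  have R: "?R \<in> carrier_mat n n" "diagonal_mat ?R" "\<And>i. i < n \<Longrightarrow> ?R $$ (i, i) \<noteq> 0"
    using D nz by (auto simp: diag_sqrt_def diag_map_def mat_diag_def diagonal_mat_def)
  have E: "diag_inv ?R \<in> carrier_mat n n"
    using R by (simp add: diag_inv_def)
  have "diag_inv ?R * D * diag_inv ?R = diag_inv ?R * (?R * ?R) * diag_inv ?R"
    by (simp add: diag_sqrt_square[OF D])
  also have "\<dots> = (diag_inv ?R * ?R) * (?R * diag_inv ?R)"
    using R E by (simp add: assoc_mult_mat_dim)
  finally show ?thesis
    by (simp add: diag_inv_sqrt_def diag_inv_mult[OF R])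
qed

section \<open>Spectrum of X D Y when Y X = I and D is diagonal\<close>

text \<open>From Y X = I follows (X D Y) X = X D, which read column by column is the eigenvector
  equation.\<close>

lemma eigenvector_biorthogonal:
  fixes X Y :: "'a::field mat"
  assumes X: "X \<in> carrier_mat n s" and Y: "Y \<in> carrier_mat s n" and YX: "Y * X = 1\<^sub>m s"
    and D: "D \<in> carrier_mat s s" "diagonal_mat D" and i: "i < s"
  shows "eigenvector (X * D * Y) (col X i) (D $$ (i, i))"
proof -
  let ?M = "X * D * Y"
  have M: "?M \<in> carrier_mat n n"
    using X Y by auto
  have "?M * X = X * D"
    using X Y D YX by (simp add: assoc_mult_mat_dim)
  then have "?M *\<^sub>v col X i = col (X * D) i"
    using col_mult2[OF M X i] by simp
  also have "\<dots> = D $$ (i, i) \<cdot>\<^sub>v col X i"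
  proof (rule eq_vecI)
    fix k assume "k < dim_vec (D $$ (i, i) \<cdot>\<^sub>v col X i)"
    then have k: "k < n"
      using X by simp
    have "X * D = Matrix.mat n s (\<lambda>(k, j). X $$ (k, j) * D $$ (j, j))"
      using arg_cong[OF diagonal_mat_eq_mat_diag[OF D], of "(*) X"] mat_diag_mult_right[OF X]
      by (rule trans)
    then show "col (X * D) i $ k = (D $$ (i, i) \<cdot>\<^sub>v col X i) $ k"
      using X i k by (simp add: mult.commute)
  qed (use X in simp)
  finally have ev: "?M *\<^sub>v col X i = D $$ (i, i) \<cdot>\<^sub>v col X i" .
  \<comment> \<open>A diagonal entry of Y X = I: column i of X pairs to 1 with a row of Y, hence is
    not the zero vector.\<close>
  have "row Y i \<bullet> col X i = 1"
    using arg_cong[OF YX, of "\<lambda>A. A $$ (i, i)"] X Y i by simp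
  moreover have "row Y i \<bullet> 0\<^sub>v n = 0"
    by (rule scalar_prod_right_zero[OF row_carrier_vec[OF i Y]])
  ultimately have "col X i \<noteq> 0\<^sub>v n"
    by (metis zero_neq_one)
  then show ?thesis
    unfolding eigenvector_def carrier_matD(1)[OF M]
    using ev X i by (intro conjI col_carrier_vec)
qed

text \<open>Left eigenvectors are eigenvectors of the transpose, which equals Y^T D X^T. So the
  previous lemma applies with Y^T and X^T in the roles of X and Y.\<close>

lemma left_eigenvector_biorthogonal:
  fixes X Y :: "'a::field mat"
  assumes X: "X \<in> carrier_mat n s" and Y: "Y \<in> carrier_mat s n" and YX: "Y * X = 1\<^sub>m s"
    and D: "D \<in> carrier_mat s s" "diagonal_mat D" and i: "i < s"
  shows "eigenvector (transpose_mat (X * D * Y)) (row Y i) (D $$ (i, i))"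
proof -
  have D': "transpose_mat D = D"
  proof (rule eq_matI)
    fix i j assume "i < dim_row D" "j < dim_col D"
    then show "transpose_mat D $$ (i, j) = D $$ (i, j)"
      using D by (cases "i = j") (auto simp: diagonal_mat_def)
  qed (use D in auto)
  have "transpose_mat (X * D * Y) = transpose_mat Y * D * transpose_mat X"
    using X Y D transpose_mult[of "X * D" n s Y n] transpose_mult[OF X D(1)]
    by (simp add: D' assoc_mult_mat_dim)
  moreover have "transpose_mat X * transpose_mat Y = 1\<^sub>m s"
    using transpose_mult[OF Y X] YX by simp
  ultimately show ?thesis
    using eigenvector_biorthogonal[of "transpose_mat Y" n s "transpose_mat X" D i] X Y D i
    by (simp only: transpose_carrier_mat col_transpose carrier_matD)
qed

text \<open>Exchange the factors X D and Y: the product in the other order is Y X D = D. Since s <=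
  n, the common factor x^s cancels and leaves x^(n - s).\<close>

lemma char_poly_biorthogonal:
  fixes X Y :: "'a::field mat"
  assumes X: "X \<in> carrier_mat n s" and Y: "Y \<in> carrier_mat s n" and YX: "Y * X = 1\<^sub>m s"
    and D: "D \<in> carrier_mat s s" "diagonal_mat D" and sn: "s \<le> n"
  shows "char_poly (X * D * Y) = monom 1 (n - s) * (\<Prod>i<s. [:- D $$ (i, i), 1:])"
proof -
  have "Y * (X * D) = D"
    using mult_cancel_left_mat[OF Y X YX] D by simp
  then have "monom 1 s * char_poly (X * D * Y) = monom 1 n * char_poly D"
    using char_poly_mult_commute[of "X * D" n s Y] X Y D by simp
  also have "monom 1 n = monom 1 s * monom (1::'a) (n - s)"
    using sn by (simp add: mult_monom)
  finally show ?thesis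
    by (simp add: mult.assoc diagonal_char_poly[OF D])
qed

lemma nonzero_eigenvalues_biorthogonal:
  fixes X Y :: "'a::field mat"
  assumes X: "X \<in> carrier_mat n s" and Y: "Y \<in> carrier_mat s n" and YX: "Y * X = 1\<^sub>m s"
    and D: "D \<in> carrier_mat s s" "diagonal_mat D" and sn: "s \<le> n"
    and nz: "\<And>i. i < s \<Longrightarrow> D $$ (i, i) \<noteq> 0"
  shows "{x. eigenvalue (X * D * Y) x \<and> x \<noteq> 0} = {D $$ (i, i) | i. i < s}"
proof -
  have "X * D * Y \<in> carrier_mat n n"
    using X Y by auto
  \<comment> \<open>The first disjunct says x = 0 if s < n and is false if s = n; in both cases it
    contributes no nonzero eigenvalue.\<close>
  then have "eigenvalue (X * D * Y) x \<longleftrightarrow> x ^ (n - s) = 0 \<or> (\<exists>i<s. x = D $$ (i, i))" for x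
    by (auto simp: eigenvalue_root_char_poly char_poly_biorthogonal[OF X Y YX D sn] poly_monom poly_prod)
  then show ?thesis
    using nz by auto
qed

section \<open>Factorization of the Nystrom matrix\<close>

text \<open>In the first product the inner Y X becomes P D Q, the pairs Q P cancel, and E D E = I
  remains. In the second, E D E = I and then P Q = I cancel in the middle. It is applied with X =
  \<open>GU\<close> and Y = \<open>GV\<close>.\<close>

lemma biorthogonal_factors:
  fixes X Y :: "'a::comm_ring_1 mat"
  assumes X: "X \<in> carrier_mat n s" and Y: "Y \<in> carrier_mat s n"
    and sim: "similar_mat_wit (Y * X) D P Q"
    and E: "E \<in> carrier_mat s s" "E * D * E = 1\<^sub>m s"
  shows "(E * Q * Y) * (X * P * E) = 1\<^sub>m s" "(X * P * E) * D * (E * Q * Y) = X * Y"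
proof -
  have "Y * X \<in> carrier_mat s s"
    using X Y by simp
  note w = similar_mat_witD2[OF this sim]
  note QP = mult_cancel_left_mat[OF w(7,6,2)] and PQ = mult_cancel_left_mat[OF w(6,7,1)]
  have YX: "Y * (X * Z) = P * (D * (Q * Z))" if "dim_row Z = s" for Z
  proof -
    have "Y * (X * Z) = (Y * X) * Z"
      using X Y that by (simp add: assoc_mult_mat_dim)
    also have "\<dots> = P * (D * (Q * Z))"
      unfolding w(3) using w that by (simp add: assoc_mult_mat_dim)
    finally show ?thesis .
  qed
  have EDE: "E * (D * (E * Z)) = Z" if "dim_row Z = s" for Z
  proof -
    have "E * (D * (E * Z)) = (E * D * E) * Z"
      using E(1) w(5) that by (simp add: assoc_mult_mat_dim)
    then show ?thesis
      using E(2) that by auto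
  qed
  have "(E * Q * Y) * (X * P * E) = E * (D * E)"
    using X Y E(1) w(5-7) by (simp add: assoc_mult_mat_dim YX QP)
  also have "\<dots> = 1\<^sub>m s"
    using E(1,2) w(5) by (simp add: assoc_mult_mat_dim)
  finally show "(E * Q * Y) * (X * P * E) = 1\<^sub>m s" .
  show "(X * P * E) * D * (E * Q * Y) = X * Y"
    using X Y E(1) w(5-7) by (simp add: assoc_mult_mat_dim EDE PQ)
qed

lemma cmat_mult: "dim_col X = dim_row Y \<Longrightarrow> cmat (X * Y) = cmat X * cmat Y"
  by (rule of_real_hom.mat_hom_mult[of _ "dim_row X" "dim_col X" _ "dim_col Y"]) auto

text \<open>Shows the inverted complex diagonal to be the image of a real matrix, so that the
  factorization below can be computed over the reals and embedded at the end.\<close>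

lemma cmat_diag_inv:
  assumes D: "D \<in> carrier_mat n n"
  shows "diag_inv (cmat D) = cmat (mat_diag n (\<lambda>i. inverse (D $$ (i, i))))"
  by (rule eq_matI) (use D in \<open>auto simp: diag_inv_def diag_map_def mat_diag_def\<close>)

text \<open>With L the inverse of \<Lambda>, the pseudo-inverse of A is U L Ui = (U L) \<Lambda> (L
  Ui). The outer factors are absorbed by the stacked matrices through A U L = U and L Ui A =
  Ui.\<close>

lemma nystrom_factorization:
  assumes A: "A \<in> carrier_mat s s" and B: "B \<in> carrier_mat s m" and F: "F \<in> carrier_mat m s"
    and dec: "eigen_decomposition A U \<Lambda> Ui" and nz: "\<And>i. i < s \<Longrightarrow> \<Lambda> $$ (i, i) \<noteq> 0"
  shows "(cmat U @\<^sub>r (cmat F * cmat U * diag_inv (cmat \<Lambda>))) * cmat \<Lambda>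
      * (cmat Ui @\<^sub>c (diag_inv (cmat \<Lambda>) * cmat Ui * cmat B)) = cmat (nystrom A B F)"
proof -
  define L where "L = mat_diag s (\<lambda>i. inverse (\<Lambda> $$ (i, i)))"
  have diag: "diagonal_mat \<Lambda>"
    using dec unfolding eigen_decomposition_def by simp
  note w = similar_mat_witD2[OF A conjunct1[OF dec[unfolded eigen_decomposition_def]]]
  have L: "L \<in> carrier_mat s s" "diag_inv (cmat \<Lambda>) = cmat L"
    unfolding L_def using w cmat_diag_inv by auto
  \<comment> \<open>The inverse relations are known for complex diagonal matrices; injectivity of
    the embedding brings them back to the reals.\<close>
  have "cmat (L * \<Lambda>) = 1\<^sub>m s" "cmat (\<Lambda> * L) = 1\<^sub>m s"
    using diag_inv_mult[of "cmat \<Lambda>" s] w(5) diag nz L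
    by (auto simp: cmat_mult diagonal_mat_def)
  then have inv: "L * \<Lambda> = 1\<^sub>m s" "\<Lambda> * L = 1\<^sub>m s"
    by (metis of_real_hom.mat_hom_inj of_real_hom.mat_hom_one)+
  note cancel = mult_cancel_left_mat[OF w(6,7,1)] mult_cancel_left_mat[OF w(7,6,2)]
    mult_cancel_left_mat[OF L(1) w(5) inv(1)] mult_cancel_left_mat[OF w(5) L(1) inv(2)]
  have AU: "A * (U * L) = U" and UA: "L * Ui * A = Ui"
    using w L inv by (simp_all add: w(3) assoc_mult_mat_dim cancel)
  have "A * (U * L * Ui) = (A * (U * L)) * Ui" "U * L * Ui * A = U * (L * Ui * A)"
    using A w L by (simp_all add: assoc_mult_mat_dim)
  then have pinv: "pseudo_inverse A = U * L * Ui"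
    using A w(1,2,6,7) L by (intro pseudo_inverse_inverse) (auto simp: AU UA)
  have AF: "A @\<^sub>r F \<in> carrier_mat (s + m) s" and AB: "A @\<^sub>c B \<in> carrier_mat s (s + m)"
    using A B F by auto
  have left: "(A @\<^sub>r F) * (U * L) = U @\<^sub>r (F * U * L)"
    using A F w(6) L(1) by (subst append_rows_mult[of _ s s _ m _ s]) (auto simp: AU assoc_mult_mat_dim)
  have right: "L * Ui * (A @\<^sub>c B) = Ui @\<^sub>c (L * Ui * B)"
    using A B w(7) L(1) by (subst mult_append_cols[of _ s s _ s _ m]) (auto simp: UA)
  \<comment> \<open>Here L is replaced by L \<Lambda> L, which makes one factor L available to each
    side.\<close>
  have "nystrom A B F = (A @\<^sub>r F) * (U * L) * \<Lambda> * (L * Ui * (A @\<^sub>c B))"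
    unfolding nystrom_def pinv using AF AB w L
    by (simp add: assoc_mult_mat_dim cancel)
  also have "\<dots> = (U @\<^sub>r (F * U * L)) * \<Lambda> * (Ui @\<^sub>c (L * Ui * B))"
    unfolding left right ..
  also have "cmat \<dots> = (cmat U @\<^sub>r (cmat F * cmat U * cmat L)) * cmat \<Lambda>
      * (cmat Ui @\<^sub>c (cmat L * cmat Ui * cmat B))"
    using w(5-7) L(1) B F
    by (simp add: cmat_mult map_mat_append_rows[of _ s s _ m] map_mat_append_cols[of _ s s _ m])
  finally show ?thesis
    unfolding L(2) ..
qed

section \<open>Trace and cost of the procedure\<close>

lemma diag_inv_diag_sqrt_dim [simp]:
  "dim_row (diag_inv D) = dim_row D" "dim_col (diag_inv D) = dim_row D"
  "dim_row (diag_sqrt D) = dim_row D" "dim_col (diag_sqrt D) = dim_row D"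
  unfolding diag_inv_def diag_sqrt_def by simp_all

text \<open>Executes the procedure symbolically, so that result, matrix shapes and costs can all be
  read off one explicit list. Products are bracketed in the order in which they are formed.\<close>

lemma nystrom_evd_eq:
  fixes B F U L Ui P S Pi :: "complex mat"
  assumes eigA: "eigA A = (U, L, Ui)"
    and GU: "GU = (U @\<^sub>r F * U * diag_inv L) * diag_sqrt L"
    and GV: "GV = diag_sqrt L * (Ui @\<^sub>c diag_inv L * (Ui * B))"
    and eigG: "eigG (GV * GU) = (P, S, Pi)"
    and carr: "U \<in> carrier_mat s s" "L \<in> carrier_mat s s" "Ui \<in> carrier_mat s s"
      "A \<in> carrier_mat s s" "B \<in> carrier_mat s m" "F \<in> carrier_mat m s"
      "P \<in> carrier_mat s s" "S \<in> carrier_mat s s" "Pi \<in> carrier_mat s s"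
    and n: "n = s + m"
  shows "nystrom_evd ec eigA eigG A B F =
    ((GU * P * diag_inv_sqrt S, S, diag_inv_sqrt S * (Pi * GV)),
     [(ec s, [U, L, Ui]), (s, [diag_inv L]), (s, [diag_sqrt L]),
      (mult_cost m s s, [F * U]), (m * s, [F * U * diag_inv L]),
      (n * s, [U @\<^sub>r F * U * diag_inv L]),
      (mult_cost s s m, [Ui * B]), (s * m, [diag_inv L * (Ui * B)]),
      (s * n, [Ui @\<^sub>c diag_inv L * (Ui * B)]),
      (n * s, [GU]), (s * n, [GV]), (mult_cost s n s, [GV * GU]),
      (ec s, [P, S, Pi]), (s, [diag_sqrt S]), (s, [diag_inv_sqrt S]),
      (mult_cost n s s, [GU * P]), (n * s, [GU * P * diag_inv_sqrt S]),
      (mult_cost s s n, [Pi * GV]), (s * n, [diag_inv_sqrt S * (Pi * GV)])])"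
proof -
  have dims: "dim_row GU = n" "dim_col GU = s" "dim_row GV = s" "dim_col GV = n"
    using carr unfolding GU GV n
    by auto
  show ?thesis
    using carr dims n
    unfolding nystrom_evd_def eig_step_def diag_inv_step_def diag_sqrt_step_def mult_step_def
      scale_cols_step_def scale_rows_step_def append_rows_step_def append_cols_step_def
      seq_def ret_def
    by (simp add: eigA eigG GU[symmetric] GV[symmetric] Let_def diag_inv_sqrt_def)
qed

text \<open>Together with the upper bound below, this makes s^2 n and the cost of forming
  \<open>GV * GU\<close> interchangeable up to a factor 2.\<close>

lemma mult_cost_lower: "s ^ 2 * n \<le> mult_cost s n s"
proof (cases n)
  case (Suc k)
  then have "n \<le> 2 * n - 1" by simp
  then show ?thesis
    unfolding mult_cost_def power2_eq_square by (rule mult_le_mono2)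
qed simp

lemma mult_cost_upper: "mult_cost s n s \<le> 2 * (s ^ 2 * n)"
proof -
  have "s * s * (2 * n - 1) \<le> s * s * (2 * n)"
    by (rule mult_le_mono2) simp
  then show ?thesis
    by (simp add: mult_cost_def power2_eq_square mult_ac)
qed

text \<open>This is the bottleneck claim: every step other than the eigensolver calls costs at most
  as much as forming \<open>GV * GU\<close>.\<close>

lemma nystrom_costs_le:
  assumes n: "n = s + m"
  shows "mult_cost m s s \<le> mult_cost s n s" "mult_cost s s m \<le> mult_cost s n s"
    "mult_cost n s s \<le> mult_cost s n s" "mult_cost s s n \<le> mult_cost s n s"
    "s \<le> mult_cost s n s" "s * n \<le> mult_cost s n s" "s * m \<le> mult_cost s n s"
proof -
  have sn: "s * n \<le> mult_cost s n s"
  proof -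
    have "s * n \<le> s ^ 2 * n"
      by (simp add: power2_eq_square)
    then show ?thesis
      using mult_cost_lower le_trans by blast
  qed
  then show "s * n \<le> mult_cost s n s" .
  show "s * m \<le> mult_cost s n s"
    using sn n by (simp add: algebra_simps)
  show "s \<le> mult_cost s n s"
  proof (cases "n = 0")
    case False
    then have "s \<le> s * n" by simp
    with sn show ?thesis by (rule le_trans[rotated])
  qed (use n in simp)
  have ns: "mult_cost n s s \<le> mult_cost s n s"
  proof (cases s)
    case (Suc k)
    \<comment> \<open>Expanded, this reads 2 n s - n <= 2 n s - s, which follows from s <=
      n.\<close>
    have "n * (2 * s - 1) \<le> s * (2 * n - 1)"
      using n by (simp add: diff_mult_distrib2 mult_ac)
    then have "s * (n * (2 * s - 1)) \<le> s * (s * (2 * n - 1))"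
      by (rule mult_le_mono2)
    then show ?thesis
      unfolding mult_cost_def by (simp only: mult_ac)
  qed (simp add: mult_cost_def)
  then show "mult_cost n s s \<le> mult_cost s n s" .
  have "mult_cost m s s \<le> mult_cost n s s"
    unfolding mult_cost_def n by (intro mult_le_mono) auto
  then show "mult_cost m s s \<le> mult_cost s n s"
    using ns by (rule le_trans)
  have eq: "mult_cost s s k = mult_cost k s s" for k
    by (simp add: mult_cost_def mult_ac)
  show "mult_cost s s m \<le> mult_cost s n s" "mult_cost s s n \<le> mult_cost s n s"
    unfolding eq by fact+
qed

section \<open>Correctness and complexity combined\<close>

text \<open>All spectral claims follow from \<open>Vo * Uo = 1\<^sub>m s\<close> and
  \<open>Uo * \<Sigma> * Vo = Mhat\<close>, all claims about the run from its explicit trace. The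
  abbreviations are equational premises, which reflexivity discharges once the \<open>let\<close> of
  the theorem is unfolded.\<close>

lemma nystrom_evd_correct:
  fixes P \<Sigma> Pi :: "complex mat" and A B F U \<Lambda> Ui :: "real mat"
  assumes sn: "s \<le> n"
    and A: "A \<in> carrier_mat s s" and B: "B \<in> carrier_mat s (n - s)" and F: "F \<in> carrier_mat (n - s) s"
    and decA: "eigen_decomposition A U \<Lambda> Ui" and nzA: "\<forall>i<s. \<Lambda> $$ (i, i) \<noteq> 0"
    and Mhat: "Mhat = cmat (nystrom A B F)"
    and Uhat: "Uhat = cmat U @\<^sub>r (cmat F * cmat U * diag_inv (cmat \<Lambda>))"
    and Vhat: "Vhat = cmat Ui @\<^sub>c (diag_inv (cmat \<Lambda>) * cmat Ui * cmat B)"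
    and GU: "GU = Uhat * diag_sqrt (cmat \<Lambda>)"
    and GV: "GV = diag_sqrt (cmat \<Lambda>) * Vhat"
    and Uo: "Uo = GU * P * diag_inv_sqrt \<Sigma>"
    and Vo: "Vo = diag_inv_sqrt \<Sigma> * Pi * GV"
    and run: "run = nystrom_evd ec eigA eigG (cmat A) (cmat B) (cmat F)"
    and decG: "eigen_decomposition (GV * GU) P \<Sigma> Pi" and nzG: "\<forall>i<s. \<Sigma> $$ (i, i) \<noteq> 0"
    and eigA: "eigA (cmat A) = (cmat U, cmat \<Lambda>, cmat Ui)"
    and eigG: "eigG (GV * GU) = (P, \<Sigma>, Pi)"
    and eig_cost: "\<And>k. ec k \<le> c * k ^ 3"
  shows "\<forall>i<s. eigenvector Mhat (col Uo i) (\<Sigma> $$ (i, i))"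
    and "\<forall>i<s. eigenvector (transpose_mat Mhat) (row Vo i) (\<Sigma> $$ (i, i))"
    and "{x. eigenvalue Mhat x \<and> x \<noteq> 0} = {\<Sigma> $$ (i, i) | i. i < s}"
    and "char_poly Mhat = monom 1 (n - s) * (\<Prod>i<s. [:- \<Sigma> $$ (i, i), 1:])"
    and "\<forall>i<s. \<forall>j<s. i \<noteq> j \<longrightarrow> row Vo i \<bullet> col Uo j = 0"
    and "Vo * Uo = 1\<^sub>m s"
    and "Uo * \<Sigma> * Vo = Mhat"
    and "fst run = (Uo, \<Sigma>, Vo)"
    and "\<forall>(k, Xs) \<in> set (steps run). \<forall>X \<in> set Xs. dim_row X \<le> s \<or> dim_col X \<le> s"
    and "s < n \<longrightarrow> (\<forall>(k, Xs) \<in> set (steps run). Mhat \<notin> set Xs)"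
    and "total_cost run \<le> (38 * (1 + c)) * (s ^ 2 * n)"
    and "(mult_cost s n s, [GV * GU]) \<in> set (steps run)"
    and "\<forall>(k, Xs) \<in> set (steps run). k \<le> max (mult_cost s n s) (ec s)"
    and "total_cost run \<le> (38 * (1 + c)) * mult_cost s n s"
proof -
  have n: "n = s + (n - s)"
    using sn by simp
  have diagA: "diagonal_mat (cmat \<Lambda>)" and diagG: "diagonal_mat \<Sigma>"
    using decA decG unfolding eigen_decomposition_def diagonal_mat_def by auto
  note wA = similar_mat_witD2[OF A conjunct1[OF decA[unfolded eigen_decomposition_def]]]
  have carrA: "cmat A \<in> carrier_mat s s" "cmat U \<in> carrier_mat s s" "cmat \<Lambda> \<in> carrier_mat s s"
    "cmat Ui \<in> carrier_mat s s" "cmat B \<in> carrier_mat s (n - s)" "cmat F \<in> carrier_mat (n - s) s"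
    using wA B F by auto
  have sqrtA: "diag_sqrt (cmat \<Lambda>) \<in> carrier_mat s s"
    and invA: "diag_inv (cmat \<Lambda>) \<in> carrier_mat s s"
    using carrA by auto
  have "Uhat \<in> carrier_mat (s + (n - s)) s" "Vhat \<in> carrier_mat s (s + (n - s))"
    unfolding Uhat Vhat using carrA invA by auto
  then have hat: "Uhat \<in> carrier_mat n s" "Vhat \<in> carrier_mat s n"
    using n by simp_all
  have carrG: "GU \<in> carrier_mat n s" "GV \<in> carrier_mat s n"
    unfolding GU GV using hat sqrtA by auto
  then have G: "GV * GU \<in> carrier_mat s s"
    by simp
  note simG = conjunct1[OF decG[unfolded eigen_decomposition_def]]
  note wG = similar_mat_witD2[OF G simG]
  have E: "diag_inv_sqrt \<Sigma> \<in> carrier_mat s s"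
    unfolding diag_inv_sqrt_def using wG(5) by auto
  have GUV: "GU * GV = Mhat"
  proof -
    have "GU * GV = Uhat * (diag_sqrt (cmat \<Lambda>) * diag_sqrt (cmat \<Lambda>)) * Vhat"
      unfolding GU GV using hat wA(5) by (simp add: assoc_mult_mat_dim)
    also have "\<dots> = Uhat * cmat \<Lambda> * Vhat"
      by (simp add: diag_sqrt_square[OF carrA(3) diagA])
    also have "\<dots> = Mhat"
      unfolding Uhat Vhat Mhat using nystrom_factorization[OF A B F decA] nzA by blast
    finally show ?thesis .
  qed
  have carr: "Uo \<in> carrier_mat n s" "Vo \<in> carrier_mat s n"
    unfolding Uo Vo using carrG wG(5-7) E by auto
  note fac = biorthogonal_factors[OF carrG simG E diag_inv_sqrt_sandwich[OF wG(5) diagG]]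
  show VU: "Vo * Uo = 1\<^sub>m s" and UDV: "Uo * \<Sigma> * Vo = Mhat"
    unfolding Uo Vo using fac nzG GUV by auto
  show "\<forall>i<s. eigenvector Mhat (col Uo i) (\<Sigma> $$ (i, i))"
    using eigenvector_biorthogonal[OF carr VU wG(5) diagG] UDV by simp
  show "\<forall>i<s. eigenvector (transpose_mat Mhat) (row Vo i) (\<Sigma> $$ (i, i))"
    using left_eigenvector_biorthogonal[OF carr VU wG(5) diagG] UDV by simp
  show "{x. eigenvalue Mhat x \<and> x \<noteq> 0} = {\<Sigma> $$ (i, i) | i. i < s}"
    using nonzero_eigenvalues_biorthogonal[OF carr VU wG(5) diagG sn] nzG UDV by simp
  show "char_poly Mhat = monom 1 (n - s) * (\<Prod>i<s. [:- \<Sigma> $$ (i, i), 1:])"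
    using char_poly_biorthogonal[OF carr VU wG(5) diagG sn] UDV by simp
  show "\<forall>i<s. \<forall>j<s. i \<noteq> j \<longrightarrow> row Vo i \<bullet> col Uo j = 0"
  proof (intro allI impI)
    fix i j assume "i < s" "j < s" "i \<noteq> j"
    then show "row Vo i \<bullet> col Uo j = 0"
      using arg_cong[OF VU, of "\<lambda>X. X $$ (i, j)"] carr by simp
  qed

  \<comment> \<open>Rebracketing \<open>GV\<close>, and then \<open>Vo\<close>, to match the order
    of multiplication in the procedure.\<close>
  have GV': "GV = diag_sqrt (cmat \<Lambda>) * (cmat Ui @\<^sub>c diag_inv (cmat \<Lambda>) * (cmat Ui * cmat B))"
    unfolding GV Vhat using carrA wA(5) by (simp add: assoc_mult_mat_dim)
  have Vo': "diag_inv_sqrt \<Sigma> * (Pi * GV) = Vo"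
    unfolding Vo using carrG wG(7) E by (simp add: assoc_mult_mat_dim)
  note run_eq = run[unfolded nystrom_evd_eq[where eigA = eigA and eigG = eigG and A = "cmat A", OF eigA GU[unfolded Uhat] GV' eigG carrA(2-4,1,5,6) wG(6,5,7) n]
      Vo' Uo[symmetric]]
  show "fst run = (Uo, \<Sigma>, Vo)"
    by (simp add: run_eq)
  show "(mult_cost s n s, [GV * GU]) \<in> set (steps run)"
    by (simp add: run_eq steps_def)
  show small: "\<forall>(k, Xs) \<in> set (steps run). \<forall>X \<in> set Xs. dim_row X \<le> s \<or> dim_col X \<le> s"
    using carrA carrG carr wG(5-7) E by (simp add: run_eq steps_def)
  have "dim_row Mhat = n" "dim_col Mhat = n"
    using GUV carrG by auto
  \<comment> \<open>Every matrix formed has a dimension of at most s, whereas both dimensions of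
    \<open>Mhat\<close> are n > s.\<close>
  then show "s < n \<longrightarrow> (\<forall>(k, Xs) \<in> set (steps run). Mhat \<notin> set Xs)"
    using small by fastforce
  show step_le: "\<forall>(k, Xs) \<in> set (steps run). k \<le> max (mult_cost s n s) (ec s)"
    using nystrom_costs_le[OF n] by (simp add: run_eq steps_def le_max_iff_disj mult.commute)
  \<comment> \<open>Since s <= n, the cubic cost c s^3 of an eigensolver call is at most c s^2
    n.\<close>
  have "ec s \<le> c * (s ^ 2 * n)"
  proof -
    have "s ^ 3 = s ^ 2 * s"
      by (simp add: power3_eq_cube power2_eq_square)
    then have "c * s ^ 3 \<le> c * (s ^ 2 * n)"
      using sn by simp
    then show ?thesis
      using eig_cost le_trans by blast
  qed
  then have ec: "ec s \<le> c * mult_cost s n s"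
    by (rule le_trans) (simp add: mult_cost_lower)
  have "fst x \<le> max (mult_cost s n s) (ec s)" if "x \<in> set (steps run)" for x
    using bspec[OF step_le that] by (simp only: case_prod_beta)
  then have "total_cost run \<le> (\<Sum>x\<leftarrow>steps run. max (mult_cost s n s) (ec s))"
    unfolding total_cost_def by (rule sum_list_mono)
  also have "\<dots> = length (steps run) * max (mult_cost s n s) (ec s)"
    by (simp only: sum_list_triv of_nat_id)
  also have "length (steps run) = 19"
    by (simp add: run_eq steps_def)
  also have "max (mult_cost s n s) (ec s) \<le> (1 + c) * mult_cost s n s"
    using ec by simp
  finally have tot: "total_cost run \<le> 19 * ((1 + c) * mult_cost s n s)"
    by simp
  then show "total_cost run \<le> (38 * (1 + c)) * mult_cost s n s"
    by (simp add: algebra_simps)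
  \<comment> \<open>Passing from the cost of forming \<open>GV * GU\<close> to s^2 n doubles the 19,
    whence 38.\<close>
  have "19 * ((1 + c) * mult_cost s n s) \<le> 19 * ((1 + c) * (2 * (s ^ 2 * n)))"
    by (intro mult_le_mono2 mult_cost_upper)
  with tot show "total_cost run \<le> (38 * (1 + c)) * (s ^ 2 * n)"
    by (simp add: algebra_simps)
qed

text \<open>K is chosen before the sizes and matrices and depends on c alone, as O(s^2 n) demands.
  The set of nonzero eigenvalues forgets multiplicities; the characteristic polynomial records them,
  including the n - s additional zeros.\<close>

theorem mainTheorem2:
  fixes ec :: "nat \<Rightarrow> nat" and c :: nat
  assumes eig_cost: "\<And>k. ec k \<le> c * k ^ 3"
  shows "\<exists>K::nat. \<forall>(n::nat) (s::nat) (M::real mat) A B F C U \<Lambda> Ui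
           (P::complex mat) \<Sigma> Pi (eigA::eigensolver) (eigG::eigensolver).
     s \<le> n \<and> M \<in> carrier_mat n n
     \<and> A \<in> carrier_mat s s \<and> B \<in> carrier_mat s (n - s)
     \<and> F \<in> carrier_mat (n - s) s \<and> C \<in> carrier_mat (n - s) (n - s)
     \<and> M = four_block_mat A B F C
     \<and> eigen_decomposition A U \<Lambda> Ui \<and> (\<forall>i<s. \<Lambda> $$ (i, i) \<noteq> 0)
     \<longrightarrow>
     (let Mhat = cmat (nystrom A B F);
          Uhat = cmat U @\<^sub>r (cmat F * cmat U * diag_inv (cmat \<Lambda>));
          Vhat = cmat Ui @\<^sub>c (diag_inv (cmat \<Lambda>) * cmat Ui * cmat B);
          GU = Uhat * diag_sqrt (cmat \<Lambda>);
          GV = diag_sqrt (cmat \<Lambda>) * Vhat;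
          Uo = GU * P * diag_inv_sqrt \<Sigma>;
          Vo = diag_inv_sqrt \<Sigma> * Pi * GV;
          run = nystrom_evd ec eigA eigG (cmat A) (cmat B) (cmat F)
      in
        eigen_decomposition (GV * GU) P \<Sigma> Pi \<and> (\<forall>i<s. \<Sigma> $$ (i, i) \<noteq> 0)
        \<and> eigA (cmat A) = (cmat U, cmat \<Lambda>, cmat Ui)
        \<and> eigG (GV * GU) = (P, \<Sigma>, Pi)
        \<longrightarrow>
        (\<forall>i<s. eigenvector Mhat (col Uo i) (\<Sigma> $$ (i, i)))
        \<and> (\<forall>i<s. eigenvector (transpose_mat Mhat) (row Vo i) (\<Sigma> $$ (i, i)))
        \<and> {x. eigenvalue Mhat x \<and> x \<noteq> 0} = {\<Sigma> $$ (i, i) | i. i < s}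
        \<and> char_poly Mhat = monom 1 (n - s) * (\<Prod>i<s. [:- \<Sigma> $$ (i, i), 1:])
        \<and> (\<forall>i<s. \<forall>j<s. i \<noteq> j \<longrightarrow> row Vo i \<bullet> col Uo j = 0)
        \<and> Vo * Uo = 1\<^sub>m s
        \<and> Uo * \<Sigma> * Vo = Mhat
        \<and> fst run = (Uo, \<Sigma>, Vo)
        \<and> (\<forall>(k, Xs) \<in> set (steps run). \<forall>X \<in> set Xs. dim_row X \<le> s \<or> dim_col X \<le> s)
        \<and> (s < n \<longrightarrow> (\<forall>(k, Xs) \<in> set (steps run). Mhat \<notin> set Xs))
        \<and> total_cost run \<le> K * (s ^ 2 * n)
        \<and> (mult_cost s n s, [GV * GU]) \<in> set (steps run)
        \<and> (\<forall>(k, Xs) \<in> set (steps run). k \<le> max (mult_cost s n s) (ec s))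
        \<and> total_cost run \<le> K * mult_cost s n s)"
  by (intro exI[of _ "38 * (1 + c)"] allI impI, unfold Let_def, intro impI, elim conjE, intro conjI;
      rule nystrom_evd_correct[OF _ _ _ _ _ _ refl refl refl refl refl refl refl refl
        _ _ _ _ eig_cost];
      assumption)

end
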